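(* Let $n \geq 5$ be an integer. Then the dual-cube $F_n$ has two completely independent spanning trees.
   Context: The dual-cube $F_n$ is the simple undirected graph with vertex set $\{0,1\}^{2n-1}$ in which two vertices $u=(u_{2n-1},\dots,u_1)$ and $v=(v_{2n-1},\dots,v_1)$ are adjacent if and only if: (1) $u$ and $v$ differ in exactly one bit position $i$; (2) if $1\le i\le n-1$ then $u_{2n-1}=v_{2n-1}=0$; (3) if $n\le i\le 2n-2$ then $u_{2n-1}=v_{2n-1}=1$. (If $i=2n-1$ there is no further condition.) Spanning trees $T_1,\dots,T_k$ ($k\ge 2$) of a graph $G$ are called completely independent if for every pair of distinct vertices $x,y$ of $G$, the $(x,y)$-paths in $T_1,\dots,T_k$ are pairwise openly disjoint, i.e. they pairwise share no edge and no internal vertex (no vertex other than $x$ and $y$). *)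

theory Defs
  imports
    "HOL-Library.FuncSet"
    "Graph_Theory.Pair_Digraph"
    "Graph_Theory.Digraph_Component"
begin

text \<open>
  Undirected simple graphs are \<^locale>\<open>pair_graph\<close>s: an edge \<open>{u, v}\<close> is the pair of arcs
  \<open>(u, v)\<close> and \<open>(v, u)\<close>.

  A vertex \<open>(u\<^bsub>2n-1\<^esub>, \<dots>, u\<^bsub>1\<^esub>)\<close> is a function \<open>u\<close> with \<open>u i\<close> the bit at position \<open>i\<close>,
  extensional outside \<open>{1..2n-1}\<close>. Intended for \<open>n \<ge> 1\<close>, since subtraction on
  \<^typ>\<open>nat\<close> truncates.
\<close>

definition dual_cube_verts :: "nat \<Rightarrow> (nat \<Rightarrow> bool) set" where
  "dual_cube_verts n = {1..2*n-1} \<rightarrow>\<^sub>E UNIV"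

definition dual_cube_adj :: "nat \<Rightarrow> (nat \<Rightarrow> bool) \<Rightarrow> (nat \<Rightarrow> bool) \<Rightarrow> bool" where
  "dual_cube_adj n u v \<longleftrightarrow>
     (\<exists>i. {j \<in> {1..2*n-1}. u j \<noteq> v j} = {i} \<and>
          (1 \<le> i \<and> i \<le> n-1 \<longrightarrow> u (2*n-1) = False \<and> v (2*n-1) = False) \<and>
          (n \<le> i \<and> i \<le> 2*n-2 \<longrightarrow> u (2*n-1) = True \<and> v (2*n-1) = True))"

definition dual_cube :: "nat \<Rightarrow> (nat \<Rightarrow> bool) pair_pre_digraph" where
  "dual_cube n =
     \<lparr> pverts = dual_cube_verts n,
       parcs = {(u, v). u \<in> dual_cube_verts n \<and> v \<in> dual_cube_verts n \<and> dual_cube_adj n u v} \<rparr>"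

lemma pair_graph_dual_cube: "pair_graph (dual_cube n)"
proof -
  have fin: "finite (dual_cube_verts n)"
    by (simp add: dual_cube_verts_def finite_PiE)
  have "finite (parcs (dual_cube n))"
    by (rule finite_subset[of _ "dual_cube_verts n \<times> dual_cube_verts n"])
       (auto simp: dual_cube_def fin)
  moreover have "dual_cube_adj n v u" if "dual_cube_adj n u v" for u v
  proof -
    have "{j \<in> {1..2*n-1}. v j \<noteq> u j} = {j \<in> {1..2*n-1}. u j \<noteq> v j}"
      by blast
    with that show ?thesis
      unfolding dual_cube_adj_def by metis
  qed
  moreover have "\<not> dual_cube_adj n u u" for u
    by (simp add: dual_cube_adj_def)
  ultimately show ?thesis
    by unfold_locales (auto simp: dual_cube_def fin symmetric_def intro!: symI)
qed

text \<open>
  The library's \<^const>\<open>forest\<close> and \<^const>\<open>tree\<close> count the closed walk \<open>a, b, a\<close> as a cycle, so no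
  symmetric digraph with an edge is a \<^const>\<open>tree\<close>. In a symmetric loop-free digraph the cycles of
  the underlying undirected graph are exactly the \<open>pre_digraph.cycle\<close>s of length at least 3.
\<close>

definition undirected_tree :: "'a pair_pre_digraph \<Rightarrow> bool" where
  "undirected_tree T \<longleftrightarrow>
     pair_graph T \<and> connected T \<and> \<not> (\<exists>p. pre_digraph.cycle T p \<and> length p \<ge> 3)"

definition undirected_spanning_tree :: "'a pair_pre_digraph \<Rightarrow> 'a pair_pre_digraph \<Rightarrow> bool" where
  "undirected_spanning_tree T G \<longleftrightarrow> undirected_tree T \<and> spanning T G"

definition path_edges :: "('a \<times> 'a) awalk \<Rightarrow> 'a set set" where
  "path_edges p = (\<lambda>(u, v). {u, v}) ` set p"

definition openly_disjoint :: "'a \<Rightarrow> 'a \<Rightarrow> ('a \<times> 'a) awalk \<Rightarrow> ('a \<times> 'a) awalk \<Rightarrow> bool" where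
  "openly_disjoint x y p q \<longleftrightarrow>
     path_edges p \<inter> path_edges q = {} \<and>
     set (pawalk_verts x p) \<inter> set (pawalk_verts x q) \<subseteq> {x, y}"

definition completely_independent_spanning_trees ::
    "'a pair_pre_digraph \<Rightarrow> 'a pair_pre_digraph list \<Rightarrow> bool" where
  "completely_independent_spanning_trees G Ts \<longleftrightarrow>
     length Ts \<ge> 2 \<and>
     (\<forall>T \<in> set Ts. undirected_spanning_tree T G) \<and>
     (\<forall>x \<in> pverts G. \<forall>y \<in> pverts G. x \<noteq> y \<longrightarrow>
       (\<forall>i < length Ts. \<forall>j < length Ts. i \<noteq> j \<longrightarrow>
         (\<forall>p q. pre_digraph.apath (Ts ! i) x p y \<and> pre_digraph.apath (Ts ! j) x q y \<longrightarrow>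
           openly_disjoint x y p q)))"

end

theory Submission
  imports Defs
begin

text \<open>
  The proof splits the vertices into two classes \<open>A\<close> and \<open>B\<close> and lets the first tree have all its
  inner vertices in \<open>A\<close> and the second all its inner vertices in \<open>B\<close>; paths of different trees then
  have no inner vertex in common. Such trees exist, and can be chosen edge-disjoint, if both classes
  induce connected subgraphs and every vertex \<open>v\<close> can be given a neighbour \<open>f v\<close> in the other class
  with \<open>f (f v) \<noteq> v\<close>: each tree spans its own class and hangs every vertex \<open>v\<close> of the other class
  on as a leaf through the edge \<open>{v, f v}\<close>. This is \<open>ex_cist_if_partition\<close>.

  For the dual-cube, put \<open>m = n - 1\<close> and let \<open>b\<close> be the word of the bits \<open>1, \<dots>, m\<close> and \<open>a\<close> the word
  of the bits \<open>m + 1, \<dots>, 2 m\<close> of a vertex. The bit \<open>2 m + 1\<close> only decides which of the two words may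
  be changed. The class of a vertex is read off the first four bits of the sum \<open>a \<oplus> b\<close>, which exist
  because \<open>n \<ge> 5\<close>: these four bits form a vertex of the 4-cube, and the 4-cube splits into
  two induced 8-cycles, the words \<open>x\<^sub>1 x\<^sub>2 x\<^sub>3 x\<^sub>4\<close> with at most one change between
  consecutive letters and those with at least two. What makes this choice work is that flipping the
  bit \<open>2 m + 1\<close> never changes the class, whereas flipping bit \<open>i\<close> or bit \<open>m + i\<close> has the same effect on
  \<open>a \<oplus> b\<close>.

  In the 4-cube every vertex has two neighbours on its own 8-cycle and two on the other one, and the
  edges between the cycles can be oriented so that every vertex has exactly one outgoing edge
  (\<open>far_bit\<close>); this yields \<open>f\<close>. For connectedness (\<open>linked_if_same_colour\<close>), two vertices of a class
  are joined by decreasing their Hamming distance. If their sums \<open>a \<oplus> b\<close> differ in the four relevant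
  bits, this succeeds because the 8-cycles are isometric in the 4-cube (\<open>coil_isometric\<close>). If the
  sums agree there, then either a bit without influence on the class can be corrected or bits \<open>i\<close> and
  \<open>m + i\<close> are both wrong; the latter two are flipped together, if necessary after moving along the
  8-cycle to a place where it traverses direction \<open>i\<close>, and back afterwards (\<open>linked_flip_both\<close>).
\<close>

section \<open>Trees given by parent maps\<close>

definition parent_tree :: "'a set \<Rightarrow> 'a \<Rightarrow> ('a \<Rightarrow> 'a) \<Rightarrow> 'a pair_pre_digraph" where
  "parent_tree V r p =
     \<lparr> pverts = V, parcs = (\<lambda>v. (v, p v)) ` (V - {r}) \<union> (\<lambda>v. (p v, v)) ` (V - {r}) \<rparr>"

lemma parcs_parent_tree_iff:
  "(a, b) \<in> parcs (parent_tree V r p) \<longleftrightarrow>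
     (a \<in> V - {r} \<and> b = p a) \<or> (b \<in> V - {r} \<and> a = p b)"
  by (auto simp: parent_tree_def)

lemma pverts_parent_tree [simp]: "pverts (parent_tree V r p) = V"
  by (simp add: parent_tree_def)

lemma (in pair_wf_digraph) apath_inner_neighbours:
  assumes path: "apath x q y" and w: "w \<in> set (pawalk_verts x q)" "w \<noteq> x" "w \<noteq> y"
  obtains a b where "(a, w) \<in> parcs G" "(w, b) \<in> parcs G" "a \<noteq> b"
    "a \<in> set (pawalk_verts x q)" "b \<in> set (pawalk_verts x q)"
proof -
  have q: "pcas x q y" "set q \<subseteq> parcs G"
    using path by (auto simp: apath_def)
  have verts: "set (pawalk_verts x q) = {x} \<union> fst ` set q \<union> snd ` set q"
    using set_awalk_verts_cas[OF q(1)] by simp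
  have "w \<in> snd ` set q"
    using w awalk_verts_conv'[OF q(1)] q(1) by (cases q) auto
  then obtain a where a: "(a, w) \<in> set q" by auto
  obtain q1 b q2 where "q = q1 @ (a, w) # (w, b) # q2" "a \<noteq> b"
    using apath_succ_decomp[OF path a w(3)] by blast
  then have b: "(w, b) \<in> set q" by simp
  have "a \<in> set (pawalk_verts x q)" "b \<in> set (pawalk_verts x q)"
    using a b unfolding verts by (auto intro: rev_image_eqI)
  then show thesis
    using that[of a b] subsetD[OF q(2) a] subsetD[OF q(2) b] \<open>a \<noteq> b\<close> by simp
qed

text \<open>
  Stated for a set of vertices rather than for the cycle itself, so that an extremal vertex of the
  cycle can be analysed without caring where the cycle starts.
\<close>

lemma (in pair_wf_digraph) cycle_neighbours:
  assumes "cycle c" "length c \<ge> 3"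
  obtains S where "finite S" "S \<noteq> {}"
    "\<And>z. z \<in> S \<Longrightarrow> \<exists>a\<in>S. \<exists>b\<in>S. a \<noteq> b \<and> (a, z) \<in> parcs G \<and> (z, b) \<in> parcs G"
proof -
  obtain u where u: "awalk u c u" "distinct (tl (pawalk_verts u c))" "c \<noteq> []"
    using assms(1) by (auto simp: cycle_def)
  then obtain w q where c: "c = (u, w) # q" "(u, w) \<in> parcs G" "apath w q u"
    by (cases c) (auto simp: awalk_Cons_iff apath_def)
  have len: "length q \<ge> 2" using assms(2) c by simp
  let ?S = "set (pawalk_verts w q)"
  have "\<exists>a\<in>?S. \<exists>b\<in>?S. a \<noteq> b \<and> (a, z) \<in> parcs G \<and> (z, b) \<in> parcs G" if z: "z \<in> ?S" for z
  proof -
    have "last (pawalk_verts w q) = u"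
      using c(3) by (auto simp only: apath_def elim: awalkE)
    then have ends: "u \<in> ?S" "w \<in> ?S"
      using last_in_set[OF awalk_verts_non_Nil, of w q] hd_in_awalk_verts(2)[OF c(3)] by simp_all
    consider "z \<noteq> w" "z \<noteq> u" | "z = w" | "z = u" by blast
    then show ?thesis
    proof cases
      case 1
      then show ?thesis by (rule apath_inner_neighbours[OF c(3) z]) blast
    next
      case 2
      obtain b q' where q: "q = (w, b) # q'" "q' \<noteq> []"
        using len c(3) by (cases q) (auto simp: apath_def awalk_Cons_iff Suc_le_length_iff)
      then have b: "apath b q' u" "(w, b) \<in> parcs G"
        using c(3) by (auto simp: apath_Cons_iff)
      have "b \<noteq> u" using apath_nonempty_ends[OF b(1) q(2)] by simp
      moreover have "b \<in> ?S" using hd_in_awalk_verts(2)[OF b(1)] q by simp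
      ultimately show ?thesis
        using 2 b(2) ends(1) c(2) by metis
    next
      case 3
      obtain q' e where q: "q = q' @ [e]" "q' \<noteq> []"
        using len by (cases q rule: rev_cases) (auto simp: Suc_le_length_iff)
      then obtain a where a: "e = (a, u)" "apath w q' a" "(a, u) \<in> parcs G"
        using c(3) by (cases e) (auto simp: apath_append_iff apath_Cons_iff apath_Nil_iff)
      have "w \<noteq> a" using apath_nonempty_ends[OF a(2) q(2)] by simp
      moreover have "pcas w q u" using c(3) by (simp add: apath_def awalk_def)
      then have "a \<in> ?S" using q(1) a(1) set_awalk_verts_cas[of w q u] by simp
      ultimately show ?thesis
        using 3 a(3) ends(2) c(2) by metis
    qed
  qed
  then show thesis using that[of ?S] awalk_verts_non_Nil[of w q] by simp
qed

text \<open>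
  The rank decreases towards the root. It makes the graph of the parent map connected, and it
  excludes cycles: both neighbours of a vertex of maximal rank on a cycle would be its parent.
\<close>

locale ranked_parents =
  fixes V :: "'a set" and r :: 'a and p :: "'a \<Rightarrow> 'a" and rk :: "'a \<Rightarrow> nat"
  assumes finite_V: "finite V" and root: "r \<in> V"
    and parent_in: "v \<in> V - {r} \<Longrightarrow> p v \<in> V"
    and parent_less: "v \<in> V - {r} \<Longrightarrow> rk (p v) < rk v"
begin

abbreviation "T \<equiv> parent_tree V r p"

lemma pair_graph_parent_tree: "pair_graph T"
proof
  show "e \<in> parcs T \<Longrightarrow> fst e \<in> pverts T" "e \<in> parcs T \<Longrightarrow> snd e \<in> pverts T" for e
    using parent_in by (cases e; auto simp: parcs_parent_tree_iff)+
  show "finite (pverts T)" "finite (parcs T)"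
    using finite_V by (auto simp: parent_tree_def)
  show "e \<in> parcs T \<Longrightarrow> fst e \<noteq> snd e" for e
    using parent_less by (cases e) (force simp: parcs_parent_tree_iff)
  show "symmetric (with_proj T)"
    by (auto simp: symmetric_def parcs_parent_tree_iff intro!: symI)
qed

sublocale tree: pair_graph T by (rule pair_graph_parent_tree)

lemma connected_parent_tree: "connected T"
proof -
  have to_root: "v \<rightarrow>\<^sup>*\<^bsub>with_proj T\<^esub> r" if "v \<in> V" for v
    using that
  proof (induction "rk v" arbitrary: v rule: less_induct)
    case less
    show ?case
    proof (cases "v = r")
      case False
      then have "p v \<rightarrow>\<^sup>*\<^bsub>with_proj T\<^esub> r"
        using less parent_in parent_less by auto
      moreover have "(v, p v) \<in> parcs T"
        using less.prems False by (simp add: parcs_parent_tree_iff)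
      ultimately show ?thesis using tree.adj_reachable_trans by blast
    qed (use root in auto)
  qed
  have "u \<rightarrow>\<^sup>*\<^bsub>with_proj T\<^esub> v" if "u \<in> V" "v \<in> V" for u v
    using tree.reachable_trans[OF to_root[OF that(1)] tree.symmetric_reachable'[OF to_root[OF that(2)]]] .
  moreover have "pverts (mk_symmetric T) = V"
    by (simp add: mk_symmetric_def)
  ultimately show ?thesis
    unfolding connected_def strongly_connected_def
    using root tree.reachable_mk_symmetric_eq[OF tree.sym_arcs] by auto
qed

lemma undirected_tree_parent_tree: "undirected_tree T"
proof -
  have "\<not> (tree.cycle c \<and> length c \<ge> 3)" for c
  proof
    assume "tree.cycle c \<and> length c \<ge> 3"
    then obtain S where S: "finite S" "S \<noteq> {}"
      "\<And>z. z \<in> S \<Longrightarrow> \<exists>a\<in>S. \<exists>b\<in>S. a \<noteq> b \<and> (a, z) \<in> parcs T \<and> (z, b) \<in> parcs T"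
      using tree.cycle_neighbours by metis
    have "Max (rk ` S) \<in> rk ` S" using S(1,2) by simp
    then obtain z where z: "z \<in> S" "rk z = Max (rk ` S)" by auto
    have z_max: "rk a \<le> rk z" if "a \<in> S" for a
      using that S(1) z(2) by simp
    have "a = p z" if "a \<in> S" "(a, z) \<in> parcs T \<or> (z, a) \<in> parcs T" for a
      using that parent_less[of a] z_max[of a] by (auto simp: parcs_parent_tree_iff)
    then show False using S(3)[OF z(1)] by metis
  qed
  then show ?thesis
    using pair_graph_parent_tree connected_parent_tree by (auto simp: undirected_tree_def)
qed

text \<open>
  An inner vertex of a path has two different neighbours, and at most one of them is its parent.
\<close>

lemma apath_inner_is_parent:
  assumes "tree.apath x q y" "w \<in> set (pawalk_verts x q)" "w \<noteq> x" "w \<noteq> y"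
  shows "w \<in> p ` (V - {r})"
  using tree.apath_inner_neighbours[OF assms] by (auto simp: parcs_parent_tree_iff)

end

text \<open>
  The distance to \<open>r\<close> serves as rank: the parent of \<open>v\<close> is the next vertex on a shortest walk from \<open>v\<close>
  to \<open>r\<close>.
\<close>

lemma ex_parent_map:
  assumes "\<And>v. v \<in> A \<Longrightarrow> (v, r) \<in> E\<^sup>*"
  shows "\<exists>p (d :: 'a \<Rightarrow> nat). \<forall>v \<in> A - {r}. (v, p v) \<in> E \<and> d (p v) < d v"
proof -
  define d where "d v = (LEAST k. (v, r) \<in> E ^^ k)" for v
  have "\<exists>w. (v, w) \<in> E \<and> d w < d v" if "v \<in> A - {r}" for v
  proof -
    have "\<exists>k. (v, r) \<in> E ^^ k" using assms that rtrancl_power by blast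
    then have "(v, r) \<in> E ^^ d v" unfolding d_def by (rule LeastI_ex)
    moreover have "d v \<noteq> 0" using calculation that by (metis DiffE insertI1 relpow_0_E)
    ultimately obtain k w where "d v = Suc k" "(v, w) \<in> E" "(w, r) \<in> E ^^ k"
      by (metis not0_implies_Suc relpow_Suc_D2)
    moreover then have "d w \<le> k" unfolding d_def by (simp add: Least_le)
    ultimately show ?thesis by auto
  qed
  then show ?thesis by metis
qed

text \<open>
  A spanning tree of the subgraph induced by \<open>X\<close>, extended by all other vertices as leaves. A leaf
  is ranked just above the vertex that it hangs on.
\<close>

lemma (in pair_graph) obtain_parents_in:
  assumes X: "X \<subseteq> pverts G" "X \<noteq> {}"
    and conn: "\<And>u v. u \<in> X \<Longrightarrow> v \<in> X \<Longrightarrow> (u, v) \<in> (parcs G \<inter> X \<times> X)\<^sup>*"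
    and f_in: "\<And>v. v \<in> pverts G - X \<Longrightarrow> f v \<in> X"
    and f_arc: "\<And>v. v \<in> pverts G - X \<Longrightarrow> (v, f v) \<in> parcs G"
  obtains r p rk where "ranked_parents (pverts G) r p rk" "p ` (pverts G - {r}) \<subseteq> X"
    "\<And>v. v \<in> pverts G - X \<Longrightarrow> p v = f v"
    "\<And>v. v \<in> pverts G - {r} \<Longrightarrow> (v, p v) \<in> parcs G"
proof -
  obtain r where r: "r \<in> X" using X(2) by blast
  obtain p and d :: "'a \<Rightarrow> nat"
    where p: "\<forall>v \<in> X - {r}. (v, p v) \<in> parcs G \<inter> X \<times> X \<and> d (p v) < d v"
    using ex_parent_map[OF conn[OF _ r]] by blast
  define p' where "p' v = (if v \<in> X then p v else f v)" for v
  define rk where "rk v = (if v \<in> X then d v else Suc (d (f v)))" for v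
  have p': "p' v \<in> X \<and> (v, p' v) \<in> parcs G \<and> rk (p' v) < rk v" if "v \<in> pverts G - {r}" for v
  proof (cases "v \<in> X")
    case True
    then show ?thesis using p that by (auto simp: p'_def rk_def)
  next
    case False
    then show ?thesis using f_in[of v] f_arc[of v] that by (auto simp: p'_def rk_def)
  qed
  have "ranked_parents (pverts G) r p' rk"
    using X(1) r p' pair_finite_verts by unfold_locales auto
  moreover have "p' ` (pverts G - {r}) \<subseteq> X" using p' by auto
  moreover have "p' v = f v" if "v \<in> pverts G - X" for v using that by (simp add: p'_def)
  ultimately show thesis using that[of r p' rk] p' by simp
qed

text \<open>
  The trees share no edge: each contains no edge inside the class of the other, and an edge between
  the classes lies in the first tree as \<open>{v, f v}\<close> with \<open>v \<in> B\<close> and in the second as \<open>{w, f w}\<close> with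
  \<open>w \<in> A\<close>, so a common one would force \<open>f v = w\<close> and \<open>f w = v\<close>.
\<close>

theorem ex_cist_if_partition:
  fixes G :: "'a pair_pre_digraph"
  assumes G: "pair_graph G"
    and part: "A \<union> B = pverts G" "A \<inter> B = {}" "A \<noteq> {}" "B \<noteq> {}"
    and connA: "\<And>u v. u \<in> A \<Longrightarrow> v \<in> A \<Longrightarrow> (u, v) \<in> (parcs G \<inter> A \<times> A)\<^sup>*"
    and connB: "\<And>u v. u \<in> B \<Longrightarrow> v \<in> B \<Longrightarrow> (u, v) \<in> (parcs G \<inter> B \<times> B)\<^sup>*"
    and f_arc: "\<And>v. v \<in> pverts G \<Longrightarrow> (v, f v) \<in> parcs G"
    and f_cross: "\<And>v. v \<in> pverts G \<Longrightarrow> f v \<in> A \<longleftrightarrow> v \<in> B"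
    and f_f: "\<And>v. v \<in> pverts G \<Longrightarrow> f (f v) \<noteq> v"
  shows "\<exists>T\<^sub>1 T\<^sub>2. completely_independent_spanning_trees G [T\<^sub>1, T\<^sub>2]"
proof -
  interpret G: pair_graph G by (rule G)
  let ?V = "pverts G"
  have f_in: "f v \<in> ?V" if "v \<in> ?V" for v
    using f_arc[OF that] G.in_arcsD2 by blast
  have A: "A \<subseteq> ?V" "?V - A = B" "\<And>v. v \<in> ?V - A \<Longrightarrow> f v \<in> A"
    using part f_cross by auto
  have B: "B \<subseteq> ?V" "?V - B = A" "\<And>v. v \<in> ?V - B \<Longrightarrow> f v \<in> B"
    using part f_cross f_in by auto
  obtain r1 p1 rk1 where T1: "ranked_parents ?V r1 p1 rk1"
      and img1: "p1 ` (?V - {r1}) \<subseteq> A" and f1: "\<And>v. v \<in> ?V - A \<Longrightarrow> p1 v = f v"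
      and arc1: "\<And>v. v \<in> ?V - {r1} \<Longrightarrow> (v, p1 v) \<in> parcs G"
    by (rule G.obtain_parents_in[OF A(1) part(3) connA A(3) f_arc]) (assumption | erule DiffD1 | rule that)+
  obtain r2 p2 rk2 where T2: "ranked_parents ?V r2 p2 rk2"
      and img2: "p2 ` (?V - {r2}) \<subseteq> B" and f2: "\<And>v. v \<in> ?V - B \<Longrightarrow> p2 v = f v"
      and arc2: "\<And>v. v \<in> ?V - {r2} \<Longrightarrow> (v, p2 v) \<in> parcs G"
    by (rule G.obtain_parents_in[OF B(1) part(4) connB B(3) f_arc]) (assumption | erule DiffD1 | rule that)+
  interpret T1: ranked_parents ?V r1 p1 rk1 by (rule T1)
  interpret T2: ranked_parents ?V r2 p2 rk2 by (rule T2)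
  let ?T1 = "parent_tree ?V r1 p1" and ?T2 = "parent_tree ?V r2 p2"
  have sub: "subgraph T G" if "pair_graph T" "pverts T = ?V" "parcs T \<subseteq> parcs G" for T
  proof -
    interpret T: pair_graph T by (rule that(1))
    show ?thesis unfolding subgraph_def compatible_def
      using that(2,3) T.wf_digraph_axioms G.wf_digraph_axioms by simp
  qed
  have "parcs ?T1 \<subseteq> parcs G" "parcs ?T2 \<subseteq> parcs G"
    using arc1 arc2 G.arcs_symmetric by (auto simp: parent_tree_def)
  then have trees: "undirected_spanning_tree ?T1 G" "undirected_spanning_tree ?T2 G"
    using sub T1.pair_graph_parent_tree T2.pair_graph_parent_tree
      T1.undirected_tree_parent_tree T2.undirected_tree_parent_tree
    by (auto simp: undirected_spanning_tree_def spanning_def)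
  have arcs_disj: "parcs ?T1 \<inter> parcs ?T2 = {}"
  proof -
    \<comment> \<open>an edge \<open>{v, p1 v} = {w, p2 w}\<close> has \<open>v = w\<close>, or each of \<open>v\<close>, \<open>w\<close> is the parent of the other\<close>
    have no_common: "p1 v \<noteq> p2 w \<or> v \<noteq> w" and no_swap: "p1 v \<noteq> w \<or> p2 w \<noteq> v"
      if v: "v \<in> ?V - {r1}" and w: "w \<in> ?V - {r2}" for v w
    proof -
      have pA: "p1 v \<in> A" using img1 v by blast
      have pB: "p2 w \<in> B" using img2 w by blast
      show "p1 v \<noteq> p2 w \<or> v \<noteq> w" using pA pB part(2) by auto
      show "p1 v \<noteq> w \<or> p2 w \<noteq> v"
      proof (rule ccontr)
        assume "\<not> (p1 v \<noteq> w \<or> p2 w \<noteq> v)"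
        then have eq: "p1 v = w" "p2 w = v" by auto
        have "v \<in> ?V - A" "w \<in> ?V - B" using pA pB eq A(2) B(2) by simp_all
        then have "f v = w" "f w = v" using f1 f2 eq by metis+
        then show False using f_f[of v] v by simp
      qed
    qed
    have "e \<notin> parcs ?T2" if "e \<in> parcs ?T1" for e
    proof
      assume "e \<in> parcs ?T2"
      with that show False
        using no_common no_swap by (cases e) (simp add: parcs_parent_tree_iff, metis)
    qed
    then show ?thesis by blast
  qed
  have disj: "openly_disjoint x y p q"
    if p: "T1.tree.apath x p y" and q: "T2.tree.apath x q y" for x y p q
  proof -
    have pq: "set p \<subseteq> parcs ?T1" "set q \<subseteq> parcs ?T2"
      using p q by (auto simp: T1.tree.apath_def T2.tree.apath_def)
    have "path_edges p \<inter> path_edges q = {}"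
    proof (rule ccontr)
      assume "path_edges p \<inter> path_edges q \<noteq> {}"
      then obtain a b c d where ab: "(a, b) \<in> set p" and cd: "(c, d) \<in> set q"
          and eq: "{a, b} = {c, d}"
        by (force simp: path_edges_def)
      have "(a, b) \<in> parcs ?T1" "(c, d) \<in> parcs ?T2" using ab cd pq by blast+
      moreover have "(b, a) \<in> parcs ?T1" using calculation(1) by (rule T1.tree.arcs_symmetric)
      moreover have "(c, d) = (a, b) \<or> (c, d) = (b, a)" using eq by (auto simp: doubleton_eq_iff)
      ultimately show False using arcs_disj by (metis IntI empty_iff)
    qed
    moreover have "set (pawalk_verts x p) \<inter> set (pawalk_verts x q) \<subseteq> {x, y}"
      using T1.apath_inner_is_parent[OF p] T2.apath_inner_is_parent[OF q] img1 img2 part(2)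
      by blast
    ultimately show ?thesis by (simp add: openly_disjoint_def)
  qed
  have disj': "openly_disjoint x y q p" if "openly_disjoint x y p q" for x y :: 'a and p q
    using that by (auto simp: openly_disjoint_def)
  have "openly_disjoint x y p q"
    if "i < 2" "j < 2" "i \<noteq> j" "pre_digraph.apath (with_proj ([?T1, ?T2] ! i)) x p y"
      "pre_digraph.apath (with_proj ([?T1, ?T2] ! j)) x q y" for x y i j p q
  proof -
    consider "i = 0" "j = 1" | "i = 1" "j = 0" using \<open>i < 2\<close> \<open>j < 2\<close> \<open>i \<noteq> j\<close> by linarith
    then show ?thesis
    proof cases
      case 1
      then show ?thesis using disj[of x p y q] that(4,5) by simp
    next
      case 2
      then show ?thesis using disj'[OF disj[of x q y p]] that(4,5) by simp
    qed
  qed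
  then have "completely_independent_spanning_trees G [?T1, ?T2]"
    using trees unfolding completely_independent_spanning_trees_def
    by (auto simp: numeral_2_eq_2)
  then show ?thesis by blast
qed

section \<open>An induced 8-cycle in the 4-cube\<close>

definition flip :: "('i \<Rightarrow> bool) \<Rightarrow> 'i \<Rightarrow> 'i \<Rightarrow> bool" where
  "flip u i = u(i := \<not> u i)"

lemma flip_apply: "flip u i j = (if j = i then \<not> u i else u j)"
  by (simp add: flip_def)

lemma flip_flip [simp]: "flip (flip u i) i = u"
  by (simp add: flip_def)

lemma flip_commute: "flip (flip u i) j = flip (flip u j) i"
  by (auto simp: flip_def fun_eq_iff)

lemma flip_flip_eq_iff [simp]: "flip (flip u i) j = u \<longleftrightarrow> i = j"
  by (auto simp: flip_def fun_eq_iff split: if_splits)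

text \<open>
  The words with at most one change between consecutive letters form the induced 8-cycle
  \<open>0000, 1000, 1100, 1110, 1111, 0111, 0011, 0001\<close>; the remaining words form another one. Consider the
  four cyclic places \<open>{1,2}, {2,3}, {3,4}, {4,1}\<close> of a word, where letters are compared for inequality
  at the first three and for equality at the last. An odd number of them respond, so exactly one
  place, the odd one out, differs from the other three. A word lies on the first cycle if one place
  responds, and on the second if three do. A flip of letter \<open>i\<close> toggles the two places containing
  \<open>i\<close>, so it stays on the cycle precisely if one of them is the odd one out.
\<close>

definition coil :: "(nat \<Rightarrow> bool) \<Rightarrow> bool" where
  "coil x \<longleftrightarrow> (x 1 = x 2 \<and> x 2 = x 3) \<or> (x 1 = x 2 \<and> x 3 = x 4) \<or> (x 2 = x 3 \<and> x 3 = x 4)"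

text \<open>
  If \<open>{j, j+1}\<close> is the odd one out, this is \<open>j + 2\<close> (cyclically), one of the two letters away from that
  place. Flipping it toggles the places \<open>{j+1, j+2}\<close> and \<open>{j+2, j+3}\<close> and so moves to the other cycle,
  where \<open>{j+3, j}\<close> is the odd one out and the far letter is \<open>j + 1\<close>, not \<open>j + 2\<close>.
\<close>

definition far_bit :: "(nat \<Rightarrow> bool) \<Rightarrow> nat" where
  "far_bit x =
     (if (x 1 = x 2) = (x 2 = x 3)
      then if (x 2 = x 3) = (x 3 = x 4) then 2 else 1
      else if (x 2 = x 3) = (x 3 = x 4) then 3 else 4)"

lemma bits_1_4: "{1..4} = {1, 2, 3, 4 :: nat}"
  by auto

lemma coil_cong: "(\<And>i. i \<in> {1..4} \<Longrightarrow> x i = y i) \<Longrightarrow> coil x = coil y"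
  by (simp add: coil_def)

lemma far_bit_range: "far_bit x \<in> {1..4}"
  by (simp add: far_bit_def)

lemma far_bit_cong:
  assumes "\<And>i. i \<in> {1..4} \<Longrightarrow> x i = y i"
  shows "far_bit x = far_bit y"
proof -
  have "x 1 = y 1" "x 2 = y 2" "x 3 = y 3" "x 4 = y 4" using assms by auto
  then show ?thesis by (simp only: far_bit_def)
qed

lemma coil_flip_far_bit: "coil (flip x (far_bit x)) \<longleftrightarrow> \<not> coil x"
  by (cases "x 1"; cases "x 2"; cases "x 3"; cases "x 4")
     (simp_all add: coil_def far_bit_def flip_apply)

lemma far_bit_flip_far_bit: "far_bit (flip x (far_bit x)) \<noteq> far_bit x"
  by (cases "x 1"; cases "x 2"; cases "x 3"; cases "x 4")
     (simp_all add: far_bit_def flip_apply)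

text \<open>
  A flip of a letter of the odd place shifts that place by one, so at most one such flip is needed
  to bring it to a place containing \<open>i\<close>.
\<close>

lemma coil_flip_reachable:
  assumes "i \<in> {1..4}"
  shows "coil (flip x i) = coil x \<or>
    (\<exists>j\<in>{1..4}. coil (flip x j) = coil x \<and> coil (flip (flip x j) i) = coil x)"
  using assms unfolding bits_1_4
  by (cases "x 1"; cases "x 2"; cases "x 3"; cases "x 4")
     (auto simp: coil_def flip_apply)

text \<open>
  Once around the 8-cycle, the directions \<open>1, 2, 3, 4, 1, 2, 3, 4\<close> are used in turn. A shortest arc
  between two of its vertices has length at most four, hence uses each direction at most once and
  only directions in which the vertices differ.
\<close>

lemma coil_isometric:
  assumes "coil x = coil y" "\<exists>i\<in>{1..4}. x i \<noteq> y i"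
  shows "\<exists>i\<in>{1..4}. x i \<noteq> y i \<and> coil (flip x i) = coil x"
  using assms unfolding bits_1_4
  by (cases "x 1"; cases "x 2"; cases "x 3"; cases "x 4")
     (auto simp: coil_def flip_apply)

section \<open>The partition of the dual-cube\<close>

definition word :: "nat \<Rightarrow> (nat \<Rightarrow> bool) \<Rightarrow> nat \<Rightarrow> bool" where
  "word m u i \<longleftrightarrow> u i \<noteq> u (m + i)"

locale dual_cube_partition =
  fixes m :: nat
  assumes m_ge_4: "m \<ge> 4"
begin

abbreviation "class_pos \<equiv> 2 * m + 1"
abbreviation "V \<equiv> dual_cube_verts (Suc m)"
abbreviation "F \<equiv> dual_cube (Suc m)"

definition colour :: "(nat \<Rightarrow> bool) \<Rightarrow> bool" where
  "colour u = coil (word m u)"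

definition colour_class :: "bool \<Rightarrow> (nat \<Rightarrow> bool) set" where
  "colour_class c = {u \<in> V. colour u = c}"

text \<open>
  Reachability inside the class of the first vertex; walks never leave that class.
\<close>

definition linked :: "(nat \<Rightarrow> bool) \<Rightarrow> (nat \<Rightarrow> bool) \<Rightarrow> bool" where
  "linked u v \<longleftrightarrow> (u, v) \<in> (parcs F \<inter> colour_class (colour u) \<times> colour_class (colour u))\<^sup>*"

lemma flip_in_verts: "u \<in> V \<Longrightarrow> i \<in> {1..class_pos} \<Longrightarrow> flip u i \<in> V"
  by (auto simp: dual_cube_verts_def flip_def PiE_iff extensional_def)

lemma arc_flip:
  assumes "u \<in> V" "i \<in> {1..class_pos}" "i \<le> m \<Longrightarrow> \<not> u class_pos" "m < i \<Longrightarrow> i \<le> 2 * m \<Longrightarrow> u class_pos"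
  shows "(u, flip u i) \<in> parcs F"
proof -
  have "{j \<in> {1..2 * Suc m - 1}. u j \<noteq> flip u i j} = {i}"
    using assms(2) by (auto simp: flip_apply split: if_splits)
  then have "dual_cube_adj (Suc m) u (flip u i)"
    unfolding dual_cube_adj_def using assms by (intro exI[of _ i]) (auto simp: flip_apply)
  then show ?thesis
    using assms flip_in_verts by (simp add: dual_cube_def)
qed

lemma colour_flip_free:
  assumes "i \<notin> {1..4}" "i \<notin> {m + 1..m + 4}"
  shows "colour (flip u i) = colour u"
  unfolding colour_def using assms m_ge_4
  by (intro coil_cong) (auto simp: word_def flip_apply)

lemma word_flip:
  assumes "j \<in> {1..4}" "i = j \<or> i = m + j" "k \<in> {1..4}"
  shows "word m (flip u i) k = flip (word m u) j k"
  using assms m_ge_4 by (auto simp: word_def flip_apply)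

lemma colour_flip:
  assumes "j \<in> {1..4}" "i = j \<or> i = m + j"
  shows "colour (flip u i) = coil (flip (word m u) j)"
  unfolding colour_def using word_flip[OF assms] by (intro coil_cong)

lemma colour_flip_class: "colour (flip u class_pos) = colour u"
  using m_ge_4 by (intro colour_flip_free) auto

lemma linked_refl: "linked u u"
  by (simp add: linked_def)

lemma linked_colour:
  assumes "linked u v"
  shows "colour v = colour u"
  using assms unfolding linked_def
  by (cases rule: rtrancl.cases) (auto simp: colour_class_def)

lemma linked_trans:
  assumes "linked u v" "linked v w"
  shows "linked u w"
  using assms linked_colour[OF assms(1)] unfolding linked_def by (simp add: rtrancl_trans)

lemma linked_arc:
  assumes "(u, v) \<in> parcs F" "colour v = colour u"
  shows "linked u v"
  using assms unfolding linked_def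
  by (intro r_into_rtrancl) (auto simp: colour_class_def dual_cube_def)

lemma linked_flip_class: "u \<in> V \<Longrightarrow> linked u (flip u class_pos)"
  by (intro linked_arc arc_flip colour_flip_class) auto

text \<open>
  Whether bit \<open>i\<close> may be flipped depends on the class bit \<open>2 m + 1\<close>. Since that bit has no influence
  on the colour, it can be switched for the step and restored afterwards.
\<close>

lemma linked_flip:
  assumes u: "u \<in> V" and i: "i \<in> {1..2 * m}" and c: "colour (flip u i) = colour u"
  shows "linked u (flip u i)"
proof (cases "u class_pos \<longleftrightarrow> m < i")
  case True
  then show ?thesis using assms by (intro linked_arc arc_flip) auto
next
  case False
  let ?v = "flip u class_pos"
  have v: "?v \<in> V" "?v class_pos \<longleftrightarrow> m < i" using False u flip_in_verts by (auto simp: flip_apply)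
  have eq: "flip ?v i = flip (flip u i) class_pos" by (rule flip_commute)
  have "linked u ?v" using u by (rule linked_flip_class)
  moreover have "colour (flip ?v i) = colour ?v"
    using c by (simp only: eq colour_flip_class)
  then have "linked ?v (flip ?v i)"
    using v i by (intro linked_arc arc_flip) auto
  moreover have "linked (flip ?v i) (flip u i)"
  proof -
    have "flip (flip ?v i) class_pos = flip u i" unfolding eq by (rule flip_flip)
    then show ?thesis
      using linked_flip_class[of "flip ?v i"] flip_in_verts[OF v(1), of i] i by simp
  qed
  ultimately show ?thesis using linked_trans by blast
qed

text \<open>
  The joint flip of \<open>i\<close> and \<open>m + i\<close> does not change the word, but the intermediate vertex may have the
  wrong colour. In this case a preliminary flip of some \<open>j\<close> moves the word to a position on its 8-cycle
  where direction \<open>i\<close> is admissible, and the same flip leads back.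
\<close>

lemma linked_flip_both:
  assumes u: "u \<in> V" and i: "i \<in> {1..m}"
  shows "linked u (flip (flip u i) (m + i))"
proof -
  have two: "linked v (flip (flip v i) (m + i))"
    if v: "v \<in> V" and c: "colour (flip v i) = colour v" for v
  proof -
    have "colour (flip (flip v i) (m + i)) = colour v"
    proof -
      have "word m (flip (flip v i) (m + i)) k = word m v k" if "k \<in> {1..4}" for k
        using i that m_ge_4 by (auto simp: word_def flip_apply)
      then show ?thesis unfolding colour_def by (rule coil_cong)
    qed
    then have "linked (flip v i) (flip (flip v i) (m + i))"
      using v i c flip_in_verts by (intro linked_flip) auto
    moreover have "linked v (flip v i)" using v i c by (intro linked_flip) auto
    ultimately show ?thesis using linked_trans by blast
  qed
  show ?thesis
  proof (cases "colour (flip u i) = colour u")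
    case True
    then show ?thesis using two u by blast
  next
    case False
    then have i4: "i \<in> {1..4}" using colour_flip_free[of i u] i by force
    have "coil (flip (word m u) i) \<noteq> colour u"
      using False colour_flip[OF i4, of i u] by simp
    then obtain j where j: "j \<in> {1..4}" "coil (flip (word m u) j) = colour u"
        "coil (flip (flip (word m u) j) i) = colour u"
      using coil_flip_reachable[OF i4, of "word m u"] unfolding colour_def by blast
    \<comment> \<open>the detour: \<open>u\<close>, then \<open>?w\<close>, then \<open>?w\<close> with both bits flipped, then back along \<open>j\<close>\<close>
    let ?w = "flip u j"
    have jm: "j \<in> {1..2 * m}" "j \<in> {1..class_pos}" using j(1) m_ge_4 by auto
    have w: "?w \<in> V" using flip_in_verts[OF u jm(2)] .
    have wc: "colour ?w = colour u" using colour_flip[OF j(1), of j u] j(2) by simp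
    have "colour (flip ?w i) = coil (flip (word m ?w) i)" using colour_flip[OF i4] by simp
    also have "\<dots> = coil (flip (flip (word m u) j) i)"
      by (rule coil_cong) (simp add: flip_apply word_flip[OF j(1)] i4)
    finally have "linked ?w (flip (flip ?w i) (m + i))" using two[OF w] j(3) wc by simp
    moreover have "linked u ?w" using linked_flip[OF u jm(1) wc] .
    moreover have "linked (flip (flip ?w i) (m + i)) (flip (flip u i) (m + i))"
      (is "linked ?x ?y")
    proof -
      have x: "?x \<in> V" using flip_in_verts w i by simp
      have y: "flip ?x j = ?y" 
        by (simp only: flip_commute[of _ "m + i" j] flip_commute[of _ i j] flip_flip)
      have "colour ?y = colour u"
      proof -
        have "word m ?y k = word m u k" if "k \<in> {1..4}" for k
          using i that m_ge_4 by (auto simp: word_def flip_apply)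
        then show ?thesis unfolding colour_def by (rule coil_cong)
      qed
      moreover have "colour ?x = colour u"
        using calculation linked_colour \<open>linked ?w ?x\<close> wc by simp
      ultimately show ?thesis using linked_flip[OF x jm(1)] y by simp
    qed
    ultimately show ?thesis using linked_trans by blast
  qed
qed

text \<open>
  Induction on the Hamming distance. When no differing bit can be flipped within the colour, only
  bits relevant to the colour differ and, by isometry of the 8-cycles, the four relevant letters of
  the words agree; thus both bits of some pair \<open>i\<close>, \<open>m + i\<close> differ and can be flipped together.
\<close>

lemma linked_if_same_colour:
  assumes "u \<in> V" "v \<in> V" "colour u = colour v"
  shows "linked u v"
  using assms
proof (induction "card {i \<in> {1..class_pos}. u i \<noteq> v i}" arbitrary: u rule: less_induct)
  case less
  let ?D = "\<lambda>u. {i \<in> {1..class_pos}. u i \<noteq> v i}"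
  have closer: ?case if w: "linked u w" "w \<in> V" "?D w \<subset> ?D u" for w
  proof -
    have "card (?D w) < card (?D u)" using w(3) by (intro psubset_card_mono) auto
    moreover have "colour w = colour v" using less.prems(3) linked_colour[OF w(1)] by simp
    ultimately have "linked w v" by (intro less.hyps w(2) less.prems(2))
    then show ?thesis by (rule linked_trans[OF w(1)])
  qed
  have D_flip: "?D (flip u i) \<subset> ?D u" if "i \<in> ?D u" for i
    using that by (auto simp: flip_apply split: if_splits)
  show ?case
  proof (cases "?D u = {}")
    case True
    then have "u = v"
      using less.prems unfolding dual_cube_verts_def by (intro PiE_ext) auto
    then show ?thesis using linked_refl by simp
  next
    case False
    show ?thesis
    proof (cases "\<exists>i \<in> ?D u. linked u (flip u i)")
      case True
      then obtain i where "i \<in> ?D u" "linked u (flip u i)" by blast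
      then show ?thesis using closer[of "flip u i"] D_flip[of i] flip_in_verts[OF less.prems(1), of i] by simp
    next
      case no_flip: False
      then have "colour (flip u i) \<noteq> colour u" if "i \<in> ?D u" for i
        using linked_flip[of u i] linked_flip_class[of u] that less.prems by (cases "i = class_pos") auto
      then have D_low: "i \<in> {1..4} \<union> {m + 1..m + 4}" if "i \<in> ?D u" for i
        using colour_flip_free[of i u] that by blast
      have same_word: "word m u k = word m v k" if k: "k \<in> {1..4}" for k
      proof (rule ccontr)
        assume "word m u k \<noteq> word m v k"
        then obtain j where j: "j \<in> {1..4}" "word m u j \<noteq> word m v j"
            "coil (flip (word m u) j) = colour u"
          using coil_isometric[OF less.prems(3)[unfolded colour_def]] k
          unfolding colour_def by blast
        then obtain i where i: "i = j \<or> i = m + j" "u i \<noteq> v i" by (auto simp: word_def)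
        then have "i \<in> ?D u" "i \<in> {1..2 * m}" using j(1) m_ge_4 by auto
        moreover have "colour (flip u i) = colour u" using colour_flip[OF j(1) i(1)] j(3) by simp
        ultimately show False using no_flip linked_flip[OF less.prems(1), of i] by blast
      qed
      obtain i where i: "i \<in> {1..4}" "u i \<noteq> v i \<or> u (m + i) \<noteq> v (m + i)"
      proof -
        obtain k where k: "k \<in> ?D u" using False by blast
        show thesis
        proof (cases "k \<in> {1..4}")
          case True
          then show thesis using that[of k] k by simp
        next
          case False
          then have "k \<in> {m + 1..m + 4}" using D_low[OF k] by blast
          then obtain i where "i \<in> {1..4}" "k = m + i"
            by (intro that[of "k - m"]) auto
          then show thesis using that[of i] k by simp
        qed
      qed
      then have both: "u i \<noteq> v i" "u (m + i) \<noteq> v (m + i)"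
        using same_word[of i] by (auto simp: word_def)
      have im: "i \<in> {1..m}" "i \<in> {1..class_pos}" "m + i \<in> {1..class_pos}" using i(1) m_ge_4 by auto
      let ?w = "flip (flip u i) (m + i)"
      have "?w \<in> V" by (intro flip_in_verts im less.prems(1))
      moreover have "?D ?w \<subset> ?D u"
      proof
        have "?w k = u k \<or> ?w k = v k" for k
          using both by (simp add: flip_apply)
        then show "?D ?w \<subseteq> ?D u" by blast
        have "i \<noteq> m + i" using m_ge_4 by simp
        then have "?w i = v i" using both(1) by (simp add: flip_apply)
        then show "?D ?w \<noteq> ?D u" using both(1) im(2) by blast
      qed
      ultimately show ?thesis by (rule closer[OF linked_flip_both[OF less.prems(1) im(1)]])
    qed
  qed
qed

text \<open>
  Position \<open>j\<close> or \<open>m + j\<close> carries letter \<open>j\<close> of the word; the class bit decides which of the two is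
  allowed to be flipped.
\<close>

definition crossing_bit :: "(nat \<Rightarrow> bool) \<Rightarrow> nat" where
  "crossing_bit u = (if u class_pos then m + far_bit (word m u) else far_bit (word m u))"

definition across :: "(nat \<Rightarrow> bool) \<Rightarrow> nat \<Rightarrow> bool" where
  "across u = flip u (crossing_bit u)"

lemma crossing_bit_cases:
  "crossing_bit u = far_bit (word m u) \<or> crossing_bit u = m + far_bit (word m u)"
  by (simp add: crossing_bit_def)

lemma crossing_bit_range:
  shows "crossing_bit u \<in> {1..2 * m}" "m < crossing_bit u \<longleftrightarrow> u class_pos"
proof -
  have "far_bit (word m u) \<in> {1..m}" using far_bit_range[of "word m u"] m_ge_4 by simp
  then show "crossing_bit u \<in> {1..2 * m}" "m < crossing_bit u \<longleftrightarrow> u class_pos"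
    by (simp_all add: crossing_bit_def)
qed

lemma arc_across:
  assumes "u \<in> V"
  shows "(u, across u) \<in> parcs F"
  unfolding across_def
proof (rule arc_flip[OF assms])
  show "crossing_bit u \<in> {1..class_pos}" using crossing_bit_range(1)[of u] by simp
qed (use crossing_bit_range(2)[of u] in simp_all)

lemma colour_across: "colour (across u) \<longleftrightarrow> \<not> colour u"
proof -
  have "colour (across u) = coil (flip (word m u) (far_bit (word m u)))"
    unfolding across_def by (rule colour_flip[OF far_bit_range crossing_bit_cases])
  then show ?thesis by (simp only: coil_flip_far_bit colour_def)
qed

text \<open>
  The class bit is the same before and after the first crossing, whereas the far letter is not;
  hence the second crossing flips a different bit.
\<close>

lemma across_across: "across (across u) \<noteq> u"
proof -
  let ?x = "word m u" and ?v = "across u"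
  have "word m ?v k = flip ?x (far_bit ?x) k" if "k \<in> {1..4}" for k
    unfolding across_def by (rule word_flip[OF far_bit_range crossing_bit_cases that])
  then have "far_bit (word m ?v) = far_bit (flip ?x (far_bit ?x))"
    by (rule far_bit_cong)
  then have "far_bit (word m ?v) \<noteq> far_bit ?x" using far_bit_flip_far_bit by simp
  moreover have "?v class_pos = u class_pos"
    using crossing_bit_range(1)[of u] by (auto simp: across_def flip_apply)
  ultimately have "crossing_bit u \<noteq> crossing_bit ?v" by (simp add: crossing_bit_def)
  moreover have "across ?v = flip (flip u (crossing_bit u)) (crossing_bit ?v)"
    by (simp only: across_def)
  ultimately show ?thesis by (simp only: flip_flip_eq_iff not_False_eq_True)
qed

end

theorem theorem2:
  fixes n :: nat
  assumes "n \<ge> 5"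
  shows "\<exists>T\<^sub>1 T\<^sub>2. completely_independent_spanning_trees (dual_cube n) [T\<^sub>1, T\<^sub>2]"
proof -
  obtain m where n: "n = Suc m" using assms by (cases n) auto
  interpret dual_cube_partition m using assms n by unfold_locales simp
  have V: "pverts F = V" by (simp add: dual_cube_def)
  have across_V: "across u \<in> V" if "u \<in> V" for u
    using arc_across[OF that] by (simp add: dual_cube_def)
  have same_colour_linked: "(u, v) \<in> (parcs F \<inter> colour_class c \<times> colour_class c)\<^sup>*"
    if "u \<in> colour_class c" "v \<in> colour_class c" for u v c
    using linked_if_same_colour[of u v] that by (simp add: linked_def colour_class_def)
  define u where "u = restrict (\<lambda>_. False) {1..2 * Suc m - 1}"
  have u: "u \<in> V" by (simp add: u_def dual_cube_verts_def)
  \<comment> \<open>any vertex and its partner across represent both colours\<close>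
  have nonempty: "colour_class c \<noteq> {}" for c
  proof (cases "colour u = c")
    case True
    then have "u \<in> colour_class c" using u by (simp add: colour_class_def)
    then show ?thesis by blast
  next
    case False
    then have "across u \<in> colour_class c"
      using across_V[OF u] colour_across[of u] by (auto simp: colour_class_def)
    then show ?thesis by blast
  qed
  show ?thesis
    unfolding n
  proof (rule ex_cist_if_partition[where A = "colour_class True" and B = "colour_class False" and f = across])
    show "pair_graph F" by (rule pair_graph_dual_cube)
    show "colour_class True \<union> colour_class False = pverts F"
      "colour_class True \<inter> colour_class False = {}"
      by (auto simp: colour_class_def V)
    show "colour_class True \<noteq> {}" "colour_class False \<noteq> {}" by (fact nonempty)+
    show "(v, across v) \<in> parcs F" if "v \<in> pverts F" for v
      using that arc_across V by simp
    show "across v \<in> colour_class True \<longleftrightarrow> v \<in> colour_class False" if "v \<in> pverts F" for v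
      using that across_V[of v] colour_across[of v] by (simp add: colour_class_def V)
    show "across (across v) \<noteq> v" for v by (rule across_across)
  qed (fact same_colour_linked)+
qed

end
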